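(* Let $\lambda_0,\lambda_1,\varepsilon,\hbar\in\mathbb{R}$, $r\in\mathbb{Z}$ with $\lambda_0\varepsilon+\lambda_1r=-\hbar$ and $\lambda_0\neq0$, and let $\mathcal{E}_\hbar$ be the left $\mathcal{C}_\hbar^\infty$-module $\mathcal{S}(\mathbb{R}\times\mathbb{Z})$ with action $$(f\xi)(x,k)=\sum_{n\in\mathbb{Z}}f_n(\lambda_0x+\lambda_1k)\,\xi(x-n\varepsilon,k-nr),\qquad f=\sum_nf_n(u)W^n.$$ For $\alpha,\beta,\gamma\in\mathbb{C}$ set $$(\nabla_1\xi)(x,k)=\alpha\,\xi'_x(x,k),\qquad(\nabla_2\xi)(x,k)=\beta x\,\xi(x,k)+\gamma k\,\xi(x,k).$$ If $\alpha=1/\lambda_0$ and $\beta\varepsilon+\gamma r=2\pi i$, then $\nabla$ is a left module connection, i.e. $\nabla_j(f\xi)=f\nabla_j\xi+(\partial_jf)\xi$ for $j=1,2$, all $\xi\in\mathcal{E}_\hbar$ and all $f\in\mathcal{C}_\hbar^\infty$.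
   Context: For $\hbar\in\mathbb{R}$, $\mathcal{C}_\hbar^\infty$ is the vector space $\mathcal{S}(\mathbb{R}\times S^1)$ of Schwartz functions ($S^1=\mathbb{R}/\mathbb{Z}$), whose elements are written $f=\sum_{n\in\mathbb{Z}}f_n(u)W^n$ with $W=e^{2\pi it}$, $f_n\in\mathcal{S}(\mathbb{R})$, with the associative product $fg=\sum_{n}\big[\sum_{k}f_k(u)g_{n-k}(u+k\hbar)\big]W^n$ and derivations $\partial_1f=\sum_nf'_n(u)W^n$, $\partial_2f=2\pi i\sum_nnf_n(u)W^n$. $\mathcal{S}(\mathbb{R}\times\mathbb{Z})$ is the space of Schwartz functions $\xi(x,k)$ in one real variable $x$ and one discrete variable $k$; $\xi'_x$ is the derivative in $x$. *)

theory Defs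
  imports "HOL-Analysis.Analysis"
begin

text \<open>
  A function on \<open>\<real> \<times> S\<^sup>1\<close>, with \<open>S\<^sup>1 = \<real>/\<int>\<close>, is a curried function of two real
  variables \<open>u\<close> and \<open>t\<close> that has period 1 in \<open>t\<close>.
\<close>

type_synonym cyl_fun = "real \<Rightarrow> real \<Rightarrow> complex"

definition partial_u :: "cyl_fun \<Rightarrow> cyl_fun" where
  "partial_u f = (\<lambda>u t. vector_derivative (\<lambda>v. f v t) (at u))"

definition partial_t :: "cyl_fun \<Rightarrow> cyl_fun" where
  "partial_t f = (\<lambda>u t. vector_derivative (\<lambda>s. f u s) (at t))"

inductive_set iterated_partials :: "cyl_fun \<Rightarrow> cyl_fun set" for f :: cyl_fun where
  self: "f \<in> iterated_partials f"
| u: "g \<in> iterated_partials f \<Longrightarrow> partial_u g \<in> iterated_partials f"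
| t: "g \<in> iterated_partials f \<Longrightarrow> partial_t g \<in> iterated_partials f"

text \<open>
  Total differentiability of all iterated partial derivatives is smoothness.
  The variable \<open>t\<close> ranges over a compact set, so only \<open>u\<close> carries a weight.
\<close>

definition schwartz_cyl :: "cyl_fun set" where
  "schwartz_cyl = {f.
     (\<forall>u t. f u (t + 1) = f u t) \<and>
     (\<forall>g\<in>iterated_partials f.
        (\<forall>p. (\<lambda>q. g (fst q) (snd q)) differentiable (at p)) \<and>
        (\<forall>a::nat. \<exists>C. \<forall>u t. \<bar>u\<bar> ^ a * norm (g u t) \<le> C))}"

definition W_power :: "int \<Rightarrow> real \<Rightarrow> complex" where
  "W_power n t = exp (2 * of_real pi * \<i> * of_int n * of_real t)"

text \<open>The coefficient \<open>f\<^sub>n(u)\<close> of \<open>W\<^sup>n\<close> in the Fourier expansion of \<open>f\<close>.\<close>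

definition fourier_coeff :: "cyl_fun \<Rightarrow> int \<Rightarrow> real \<Rightarrow> complex" where
  "fourier_coeff f n u = integral {0..1} (\<lambda>t. f u t * W_power (- n) t)"

definition cyl_mult :: "real \<Rightarrow> cyl_fun \<Rightarrow> cyl_fun \<Rightarrow> cyl_fun" where
  "cyl_mult h f g = (\<lambda>u t. \<Sum>\<^sub>\<infinity>n::int.
     (\<Sum>\<^sub>\<infinity>k::int. fourier_coeff f k u * fourier_coeff g (n - k) (u + of_int k * h)) * W_power n t)"

definition cyl_deriv1 :: "cyl_fun \<Rightarrow> cyl_fun" where
  "cyl_deriv1 f = (\<lambda>u t. \<Sum>\<^sub>\<infinity>n::int. vector_derivative (fourier_coeff f n) (at u) * W_power n t)"

definition cyl_deriv2 :: "cyl_fun \<Rightarrow> cyl_fun" where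
  "cyl_deriv2 f = (\<lambda>u t. 2 * of_real pi * \<i> *
     (\<Sum>\<^sub>\<infinity>n::int. of_int n * fourier_coeff f n u * W_power n t))"

type_synonym mod_fun = "real \<Rightarrow> int \<Rightarrow> complex"

definition partial_x :: "mod_fun \<Rightarrow> mod_fun" where
  "partial_x \<xi> = (\<lambda>x k. vector_derivative (\<lambda>y. \<xi> y k) (at x))"

definition schwartz_mod :: "mod_fun set" where
  "schwartz_mod = {\<xi>. \<forall>m::nat.
     (\<forall>k x. (\<lambda>y. (partial_x ^^ m) \<xi> y k) differentiable (at x)) \<and>
     (\<forall>(a::nat) b::nat. \<exists>C. \<forall>x k.
        \<bar>x\<bar> ^ a * \<bar>real_of_int k\<bar> ^ b * norm ((partial_x ^^ m) \<xi> x k) \<le> C)}"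

definition mod_action ::
    "real \<Rightarrow> real \<Rightarrow> real \<Rightarrow> int \<Rightarrow> cyl_fun \<Rightarrow> mod_fun \<Rightarrow> mod_fun" where
  "mod_action l0 l1 \<epsilon> r f \<xi> = (\<lambda>x k. \<Sum>\<^sub>\<infinity>n::int.
     fourier_coeff f n (l0 * x + l1 * of_int k) * \<xi> (x - of_int n * \<epsilon>) (k - n * r))"

definition nabla1 :: "complex \<Rightarrow> mod_fun \<Rightarrow> mod_fun" where
  "nabla1 \<alpha> \<xi> = (\<lambda>x k. \<alpha> * partial_x \<xi> x k)"

definition nabla2 :: "complex \<Rightarrow> complex \<Rightarrow> mod_fun \<Rightarrow> mod_fun" where
  "nabla2 \<beta> \<gamma> \<xi> = (\<lambda>x k. \<beta> * of_real x * \<xi> x k + \<gamma> * of_int k * \<xi> x k)"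

text \<open>
  The algebra with product \<open>cyl_mult h\<close> has no unit, so there is no unit law.
\<close>

definition left_module :: "real \<Rightarrow> (cyl_fun \<Rightarrow> mod_fun \<Rightarrow> mod_fun) \<Rightarrow> bool" where
  "left_module h act \<longleftrightarrow>
     (\<forall>f\<in>schwartz_cyl. \<forall>\<xi>\<in>schwartz_mod. act f \<xi> \<in> schwartz_mod) \<and>
     (\<forall>f\<in>schwartz_cyl. \<forall>g\<in>schwartz_cyl. \<forall>\<xi>\<in>schwartz_mod.
        act (\<lambda>u t. f u t + g u t) \<xi> = (\<lambda>x k. act f \<xi> x k + act g \<xi> x k)) \<and>
     (\<forall>f\<in>schwartz_cyl. \<forall>\<xi>\<in>schwartz_mod. \<forall>\<eta>\<in>schwartz_mod.
        act f (\<lambda>x k. \<xi> x k + \<eta> x k) = (\<lambda>x k. act f \<xi> x k + act f \<eta> x k)) \<and>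
     (\<forall>c. \<forall>f\<in>schwartz_cyl. \<forall>\<xi>\<in>schwartz_mod.
        act (\<lambda>u t. c * f u t) \<xi> = (\<lambda>x k. c * act f \<xi> x k) \<and>
        act f (\<lambda>x k. c * \<xi> x k) = (\<lambda>x k. c * act f \<xi> x k)) \<and>
     (\<forall>f\<in>schwartz_cyl. \<forall>g\<in>schwartz_cyl. \<forall>\<xi>\<in>schwartz_mod.
        act (cyl_mult h f g) \<xi> = act f (act g \<xi>))"

definition covariant_derivative ::
    "(cyl_fun \<Rightarrow> mod_fun \<Rightarrow> mod_fun) \<Rightarrow> (cyl_fun \<Rightarrow> cyl_fun) \<Rightarrow> (mod_fun \<Rightarrow> mod_fun) \<Rightarrow> bool" where
  "covariant_derivative act \<delta> D \<longleftrightarrow>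
     (\<forall>\<xi>\<in>schwartz_mod. D \<xi> \<in> schwartz_mod) \<and>
     (\<forall>\<xi>\<in>schwartz_mod. \<forall>\<eta>\<in>schwartz_mod.
        D (\<lambda>x k. \<xi> x k + \<eta> x k) = (\<lambda>x k. D \<xi> x k + D \<eta> x k)) \<and>
     (\<forall>c. \<forall>\<xi>\<in>schwartz_mod. D (\<lambda>x k. c * \<xi> x k) = (\<lambda>x k. c * D \<xi> x k)) \<and>
     (\<forall>f\<in>schwartz_cyl. \<forall>\<xi>\<in>schwartz_mod.
        D (act f \<xi>) = (\<lambda>x k. act f (D \<xi>) x k + act (\<delta> f) \<xi> x k))"

definition left_module_connection ::
    "real \<Rightarrow> (cyl_fun \<Rightarrow> mod_fun \<Rightarrow> mod_fun) \<Rightarrow> (mod_fun \<Rightarrow> mod_fun) \<Rightarrow> (mod_fun \<Rightarrow> mod_fun) \<Rightarrow> bool"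
  where
  "left_module_connection h act D\<^sub>1 D\<^sub>2 \<longleftrightarrow>
     left_module h act \<and>
     covariant_derivative act cyl_deriv1 D\<^sub>1 \<and>
     covariant_derivative act cyl_deriv2 D\<^sub>2"

end

theory Submission
  imports Defs
begin

text \<open>
  The Fourier coefficients of a Schwartz function decay faster than any power of \<open>n\<close>, uniformly in
  \<open>u\<close>, since \<open>\<partial>\<^sub>t\<close> multiplies them by \<open>2 \<pi> i n\<close>. Hence all series over \<open>n\<close> converge
  absolutely and uniformly, and may be differentiated in \<open>x\<close> and integrated in \<open>t\<close> term by term.
  The latter recovers the coefficients of a product or of \<open>\<partial>\<^sub>j f\<close> from the defining
  series, so Fourier inversion is never needed. Associativity is then a reindexing of a double sum in
  which \<open>\<lambda>\<^sub>0 \<epsilon> + \<lambda>\<^sub>1 r = - h\<close> matches the arguments of the coefficients of \<open>g\<close>.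
  The Leibniz rule for \<open>\<nabla>\<^sub>1\<close> is the product rule together with \<open>\<alpha> \<lambda>\<^sub>0 = 1\<close>. That for
  \<open>\<nabla>\<^sub>2\<close> holds because \<open>\<beta> x + \<gamma> k\<close> drops by
  \<open>n (\<beta> \<epsilon> + \<gamma> r) = 2 \<pi> i n\<close> under the shift by \<open>n\<close> steps.
\<close>

section \<open>Fourier coefficients\<close>

lemma W_power_add: "W_power (m + n) t = W_power m t * W_power n t"
  by (simp add: W_power_def ring_distribs flip: exp_add)

lemma W_power_0_left [simp]: "W_power 0 t = 1"
  by (simp add: W_power_def)

lemma W_power_0_right [simp]: "W_power n 0 = 1"
  by (simp add: W_power_def)

lemma W_power_1_right [simp]: "W_power n 1 = 1"
  by (auto simp: W_power_def exp_eq_1 intro!: exI[of _ n])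

lemma norm_W_power [simp]: "norm (W_power n t) = 1"
  by (simp add: W_power_def norm_exp_eq_Re)

lemma W_power_has_vector_derivative:
  "(W_power n has_vector_derivative 2 * of_real pi * \<i> * of_int n * W_power n t) (at t within S)"
proof -
  have "((\<lambda>z. exp (2 * of_real pi * \<i> * of_int n * z)) has_field_derivative
          2 * of_real pi * \<i> * of_int n * W_power n t) (at (of_real t))"
    unfolding W_power_def by (auto intro!: derivative_eq_intros)
  from has_vector_derivative_real_field[OF this] show ?thesis
    unfolding W_power_def[abs_def] by (rule has_vector_derivative_at_within)
qed

lemma continuous_on_W_power [continuous_intros]: "continuous_on S (W_power n)"
  using W_power_has_vector_derivative by (rule continuous_on_vector_derivative)

text \<open>For nonzero \<open>n\<close>, a nonzero multiple of \<open>W_power n\<close> is its own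
  derivative's integrand, and \<open>W_power n\<close> takes the value 1 at both endpoints. This
  orthogonality later reads coefficients off a series.\<close>

lemma integral_W_power: "integral {0..1} (W_power n) = (if n = 0 then 1 else 0)"
proof (cases "n = 0")
  case True
  then have "W_power n = (\<lambda>t. 1)" by (simp add: fun_eq_iff)
  then show ?thesis using True by simp
next
  case False
  have "((\<lambda>t. 2 * of_real pi * \<i> * of_int n * W_power n t) has_integral (W_power n 1 - W_power n 0)) {0..1}"
    by (rule fundamental_theorem_of_calculus) (auto intro: W_power_has_vector_derivative)
  from integral_unique[OF this] False show ?thesis by simp
qed

section \<open>Schwartz functions on the cylinder and their partial derivatives\<close>

lemma schwartz_cyl_periodic: "f \<in> schwartz_cyl \<Longrightarrow> f u (t + 1) = f u t"
  by (simp add: schwartz_cyl_def)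

lemma schwartz_cyl_differentiable:
  "f \<in> schwartz_cyl \<Longrightarrow> (\<lambda>q. f (fst q) (snd q)) differentiable (at p)"
  using iterated_partials.self[of f] unfolding schwartz_cyl_def by blast

lemma schwartz_cyl_bounded:
  assumes "f \<in> schwartz_cyl"
  obtains C where "\<And>u t. norm (f u t) \<le> C"
proof -
  have "\<exists>C. \<forall>u t. \<bar>u\<bar> ^ 0 * norm (f u t) \<le> C"
    using assms iterated_partials.self unfolding schwartz_cyl_def by blast
  then show ?thesis using that by auto
qed

lemma schwartz_cyl_continuous:
  assumes "f \<in> schwartz_cyl"
  shows "continuous_on S (\<lambda>q. f (fst q) (snd q))"
  by (intro differentiable_imp_continuous_on differentiable_at_imp_differentiable_on
      schwartz_cyl_differentiable assms)

lemma schwartz_cyl_continuous_t: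
  assumes "f \<in> schwartz_cyl"
  shows "continuous_on S (f u)"
  using continuous_on_compose2[OF schwartz_cyl_continuous[OF assms, of UNIV], of S "Pair u"]
  by (simp add: continuous_intros)

lemma has_vector_derivative_partial_u:
  assumes "f \<in> schwartz_cyl"
  shows "((\<lambda>v. f v t) has_vector_derivative partial_u f u t) (at u)"
proof -
  \<comment> \<open>The jointly differentiable function is composed with the affine embedding of a
    line of constant \<open>t\<close>.\<close>
  have "(\<lambda>v. (\<lambda>q. f (fst q) (snd q)) (v, t)) differentiable (at u)"
    by (rule differentiable_compose[OF schwartz_cyl_differentiable[OF assms]])
      (auto intro!: derivative_intros simp: differentiable_def)
  then show ?thesis by (simp add: partial_u_def vector_derivative_works)
qed

lemma has_vector_derivative_partial_t:
  assumes "f \<in> schwartz_cyl"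
  shows "(f u has_vector_derivative partial_t f u t) (at t)"
proof -
  have "(\<lambda>s. (\<lambda>q. f (fst q) (snd q)) (u, s)) differentiable (at t)"
    by (rule differentiable_compose[OF schwartz_cyl_differentiable[OF assms]])
      (auto intro!: derivative_intros simp: differentiable_def)
  then show ?thesis by (simp add: partial_t_def vector_derivative_works)
qed

text \<open>Lets the smoothness and decay conditions on \<open>f\<close> pass to its partial
  derivatives, whose iterated partials are among those of \<open>f\<close>.\<close>

lemma iterated_partials_trans:
  assumes "h \<in> iterated_partials g" "g \<in> iterated_partials f"
  shows "h \<in> iterated_partials f"
  using assms by induction (auto intro: iterated_partials.intros)

lemma partial_u_schwartz_cyl:
  assumes "f \<in> schwartz_cyl"
  shows "partial_u f \<in> schwartz_cyl"
proof -
  have "h \<in> iterated_partials f" if "h \<in> iterated_partials (partial_u f)" for h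
    using that by (rule iterated_partials_trans) (intro iterated_partials.intros)
  moreover have "partial_u f u (t + 1) = partial_u f u t" for u t
    using assms by (simp add: partial_u_def schwartz_cyl_periodic)
  ultimately show ?thesis using assms by (simp add: schwartz_cyl_def)
qed

text \<open>In contrast to \<open>partial_u\<close>, the derivative is taken in the periodic
  variable itself, so its periodicity comes from the chain rule for the shift by 1.\<close>

lemma partial_t_schwartz_cyl:
  assumes "f \<in> schwartz_cyl"
  shows "partial_t f \<in> schwartz_cyl"
proof -
  have "h \<in> iterated_partials f" if "h \<in> iterated_partials (partial_t f)" for h
    using that by (rule iterated_partials_trans) (intro iterated_partials.intros)
  moreover have "partial_t f u (t + 1) = partial_t f u t" for u t
  proof -
    have "((f u \<circ> (\<lambda>s. s + 1)) has_vector_derivative 1 *\<^sub>R partial_t f u (t + 1)) (at t)"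
      by (rule vector_diff_chain_at)
        (auto intro!: derivative_eq_intros has_vector_derivative_partial_t assms)
    then have "(f u has_vector_derivative partial_t f u (t + 1)) (at t)"
      using assms by (simp add: o_def schwartz_cyl_periodic)
    then show ?thesis by (simp add: partial_t_def vector_derivative_at)
  qed
  ultimately show ?thesis using assms by (simp add: schwartz_cyl_def)
qed

section \<open>Linearity, differentiation and decay of the coefficients\<close>

lemma fourier_integrand_integrable:
  assumes "f \<in> schwartz_cyl"
  shows "(\<lambda>t. f u t * W_power n t) integrable_on {0..1}"
  by (intro integrable_continuous_real continuous_intros schwartz_cyl_continuous_t assms)

lemma fourier_coeff_add:
  assumes "f \<in> schwartz_cyl" "g \<in> schwartz_cyl"
  shows "fourier_coeff (\<lambda>u t. f u t + g u t) n u = fourier_coeff f n u + fourier_coeff g n u"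
  using assms by (simp add: fourier_coeff_def distrib_right integral_add fourier_integrand_integrable)

lemma fourier_coeff_cmult: "fourier_coeff (\<lambda>u t. c * f u t) n u = c * fourier_coeff f n u"
  by (simp add: fourier_coeff_def mult.assoc)

text \<open>Differentiation under the integral sign: the interval is compact and the
  \<open>u\<close>-derivative of the integrand is jointly continuous, because
  \<open>partial_u f\<close> is again Schwartz.\<close>

lemma fourier_coeff_has_vector_derivative:
  assumes "f \<in> schwartz_cyl"
  shows "(fourier_coeff f n has_vector_derivative fourier_coeff (partial_u f) n u) (at u)"
proof -
  have "((\<lambda>u. integral (cbox 0 1) (\<lambda>t. f u t * W_power (- n) t)) has_vector_derivative
          integral (cbox 0 1) (\<lambda>t. partial_u f u t * W_power (- n) t)) (at u within UNIV)"
  proof (rule leibniz_rule_vector_derivative)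
    show "continuous_on (UNIV \<times> cbox 0 1) (\<lambda>(u, t). partial_u f u t * W_power (- n) t)"
      unfolding case_prod_beta
      by (intro continuous_intros schwartz_cyl_continuous partial_u_schwartz_cyl assms
          continuous_on_compose2[OF continuous_on_W_power[of UNIV]]) auto
    show "((\<lambda>u. f u t * W_power (- n) t) has_vector_derivative partial_u f u t * W_power (- n) t)
        (at u within UNIV)" for u t
      by (auto intro!: derivative_eq_intros has_vector_derivative_partial_u assms)
  qed (use fourier_integrand_integrable[OF assms] in auto)
  then show ?thesis by (simp add: fourier_coeff_def[abs_def])
qed

text \<open>Integration by parts over one period; the boundary terms cancel because
  \<open>f u\<close> and \<open>W_power (- n)\<close> agree at 0 and 1.\<close>

lemma fourier_coeff_partial_t:
  assumes "f \<in> schwartz_cyl"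
  shows "fourier_coeff (partial_t f) n u = 2 * of_real pi * \<i> * of_int n * fourier_coeff f n u"
proof -
  let ?c = "2 * of_real pi * \<i> * of_int n :: complex"
  have "((\<lambda>t. f u t * (2 * of_real pi * \<i> * of_int (- n) * W_power (- n) t) + partial_t f u t * W_power (- n) t)
      has_integral (f u 1 * W_power (- n) 1 - f u 0 * W_power (- n) 0)) {0..1}"
    by (intro fundamental_theorem_of_calculus has_vector_derivative_mult
        W_power_has_vector_derivative has_vector_derivative_at_within[OF has_vector_derivative_partial_t] assms) auto
  then have "((\<lambda>t. partial_t f u t * W_power (- n) t - ?c * (f u t * W_power (- n) t)) has_integral 0) {0..1}"
    using schwartz_cyl_periodic[OF assms, of u 0] by (simp add: algebra_simps)
  moreover have "((\<lambda>t. partial_t f u t * W_power (- n) t - ?c * (f u t * W_power (- n) t)) has_integral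
      (fourier_coeff (partial_t f) n u - ?c * fourier_coeff f n u)) {0..1}"
    unfolding fourier_coeff_def
    by (intro has_integral_diff has_integral_mult_right integrable_integral
        fourier_integrand_integrable partial_t_schwartz_cyl assms)
  ultimately have "0 = fourier_coeff (partial_t f) n u - ?c * fourier_coeff f n u"
    by (rule has_integral_unique)
  then show ?thesis by simp
qed

lemma norm_fourier_coeff_le:
  assumes "f \<in> schwartz_cyl" "\<And>u t. norm (f u t) \<le> C"
  shows "norm (fourier_coeff f n u) \<le> C"
proof -
  have "norm (integral {0..1} (\<lambda>t. f u t * W_power (- n) t)) \<le> C * (1 - 0)"
  proof (rule integral_bound)
    show "continuous_on {0..1} (\<lambda>t. f u t * W_power (- n) t)"
      by (intro continuous_intros schwartz_cyl_continuous_t assms)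
  qed (simp_all add: norm_mult assms)
  then show ?thesis by (simp add: fourier_coeff_def)
qed

text \<open>Induction on \<open>b\<close> for all \<open>f\<close> at once. One factor
  \<open>1 + \<bar>n\<bar>\<close> is split into its two summands: the first leaves
  \<open>f\<close>, and the second is absorbed by passing to \<open>partial_t f\<close>, whose
  coefficients carry the factor \<open>2 * pi * \<bar>n\<bar>\<close>.\<close>

lemma fourier_coeff_decay:
  assumes "f \<in> schwartz_cyl"
  obtains C where "\<And>n u. (1 + \<bar>real_of_int n\<bar>) ^ b * norm (fourier_coeff f n u) \<le> C"
proof -
  have "\<exists>C. \<forall>n u. (1 + \<bar>real_of_int n\<bar>) ^ b * norm (fourier_coeff f n u) \<le> C"
    using assms
  proof (induction b arbitrary: f)
    case 0
    then show ?case
      by (metis schwartz_cyl_bounded norm_fourier_coeff_le power_0 mult_1)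
  next
    case (Suc b)
    obtain C D where C: "\<And>n u. (1 + \<bar>real_of_int n\<bar>) ^ b * norm (fourier_coeff f n u) \<le> C"
      and D: "\<And>n u. (1 + \<bar>real_of_int n\<bar>) ^ b * norm (fourier_coeff (partial_t f) n u) \<le> D"
      using Suc.IH[OF Suc.prems] Suc.IH[OF partial_t_schwartz_cyl[OF Suc.prems]] by metis
    have "(1 + \<bar>real_of_int n\<bar>) ^ Suc b * norm (fourier_coeff f n u) \<le> C + D" for n u
    proof -
      have "\<bar>real_of_int n\<bar> * 1 \<le> \<bar>real_of_int n\<bar> * (2 * pi)"
        using pi_gt3 by (intro mult_left_mono) auto
      then have "\<bar>real_of_int n\<bar> * norm (fourier_coeff f n u) \<le> norm (fourier_coeff (partial_t f) n u)"
        unfolding fourier_coeff_partial_t[OF Suc.prems] norm_mult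
        by (intro mult_right_mono) (auto simp: mult_ac)
      then have "(1 + \<bar>real_of_int n\<bar>) ^ b * (\<bar>real_of_int n\<bar> * norm (fourier_coeff f n u))
          \<le> (1 + \<bar>real_of_int n\<bar>) ^ b * norm (fourier_coeff (partial_t f) n u)"
        by (rule mult_left_mono) simp
      moreover have "(1 + \<bar>real_of_int n\<bar>) ^ Suc b * norm (fourier_coeff f n u)
          = (1 + \<bar>real_of_int n\<bar>) ^ b * norm (fourier_coeff f n u)
            + (1 + \<bar>real_of_int n\<bar>) ^ b * (\<bar>real_of_int n\<bar> * norm (fourier_coeff f n u))"
        by (simp add: algebra_simps)
      ultimately show ?thesis using C[of n u] D[of n u] by linarith
    qed
    then show ?case by blast
  qed
  then show ?thesis using that by blast
qed

section \<open>Termwise integration and differentiation\<close>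

text \<open>This weight is the common majorant of the series below. The integers are covered by the
  naturals and their negatives; the overlap at 0 does no harm to summability.\<close>

lemma summable_on_int_inverse_square:
  "(\<lambda>n::int. 1 / (1 + \<bar>real_of_int n\<bar>) ^ 2) summable_on UNIV"
proof -
  have "summable (\<lambda>n. inverse (real (Suc n) ^ 2))"
    using inverse_power_summable[of 2, where 'a=real] by (subst summable_Suc_iff) auto
  then have nat: "(\<lambda>n::nat. 1 / (1 + real n) ^ 2) summable_on UNIV"
    by (intro norm_summable_imp_summable_on) (simp add: field_simps)
  have "(\<lambda>n::int. 1 / (1 + \<bar>real_of_int n\<bar>) ^ 2) summable_on range int"
    by (subst summable_on_reindex) (use nat in \<open>auto simp: o_def\<close>)
  moreover have "(\<lambda>n::int. 1 / (1 + \<bar>real_of_int n\<bar>) ^ 2) summable_on range (\<lambda>n. - int n)"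
    by (subst summable_on_reindex) (use nat in \<open>auto simp: o_def inj_on_def\<close>)
  ultimately have "(\<lambda>n::int. 1 / (1 + \<bar>real_of_int n\<bar>) ^ 2) summable_on (range int \<union> range (\<lambda>n. - int n))"
    by (rule summable_on_union)
  moreover have "range int \<union> range (\<lambda>n. - int n) = UNIV"
    by (auto simp: image_iff) (metis int_cases2)
  ultimately show ?thesis by simp
qed

text \<open>By the Weierstrass M-test the finite partial sums converge uniformly along the net of
  finite index sets, and integration commutes with uniform limits.\<close>

lemma has_integral_infsum:
  fixes f :: "'a \<Rightarrow> real \<Rightarrow> 'b::banach"
  assumes cont: "\<And>n. continuous_on {a..b} (f n)"
    and bound: "\<And>n x. x \<in> {a..b} \<Longrightarrow> norm (f n x) \<le> M n"
    and M: "M summable_on UNIV"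
    and integral: "\<And>n. (f n has_integral I n) {a..b}"
  shows "((\<lambda>x. \<Sum>\<^sub>\<infinity>n. f n x) has_integral (\<Sum>\<^sub>\<infinity>n. I n)) {a..b}"
proof -
  let ?fin = "finite_subsets_at_top (UNIV :: 'a set)"
  have unif: "uniform_limit {a..b} (\<lambda>A x. \<Sum>n\<in>A. f n x) (\<lambda>x. \<Sum>\<^sub>\<infinity>n. f n x) ?fin"
    by (rule Weierstrass_m_test_general[OF bound M])
  have cont_sum: "continuous_on {a..b} (\<lambda>x. \<Sum>n\<in>A. f n x)" for A
    by (intro continuous_on_sum cont)
  have fin: "?fin \<noteq> bot" by simp
  show ?thesis
  proof (rule uniform_limit_integral[OF unif cont_sum fin])
    fix I' J
    assume I': "\<And>A. ((\<lambda>x. \<Sum>n\<in>A. f n x) has_integral I' A) {a..b}"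
      and J: "((\<lambda>x. \<Sum>\<^sub>\<infinity>n. f n x) has_integral J) {a..b}"
      and lim: "(I' \<longlongrightarrow> J) ?fin"
    \<comment> \<open>The limit theorem supplies some integrals \<open>I'\<close> of the partial
      sums; uniqueness identifies them with sums of \<open>I\<close>, so their limit
      \<open>J\<close> is the sum of \<open>I\<close>.\<close>
    have "I' A = sum I A" if "finite A" for A
      using I' has_integral_sum[OF that integral] by (rule has_integral_unique)
    then have "eventually (\<lambda>A. I' A = sum I A) ?fin"
      by (intro eventually_finite_subsets_at_top_weakI) simp
    then have "(sum I \<longlongrightarrow> J) ?fin" using lim by (simp cong: tendsto_cong)
    then have "(I has_sum J) UNIV" by (simp add: has_sum_def)
    with J show ?thesis by (simp add: infsumI)
  qed
qed

text \<open>Reduced to termwise integration: the sum \<open>G\<close> of the derivatives is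
  continuous as a uniform limit and integrates to the increments of \<open>F\<close>, so the
  fundamental theorem of calculus makes it the derivative of \<open>F\<close>.\<close>

lemma infsum_has_vector_derivative:
  fixes f f' :: "'a \<Rightarrow> real \<Rightarrow> 'b::banach"
  assumes deriv: "\<And>n x. (f n has_vector_derivative f' n x) (at x)"
    and cont: "\<And>n. continuous_on UNIV (f' n)"
    and bound: "\<And>n x. norm (f' n x) \<le> M n"
    and M: "M summable_on UNIV"
    and summable: "\<And>x. (\<lambda>n. f n x) summable_on UNIV"
  shows "((\<lambda>x. \<Sum>\<^sub>\<infinity>n. f n x) has_vector_derivative (\<Sum>\<^sub>\<infinity>n. f' n x)) (at x)"
proof -
  define F where "F = (\<lambda>x. \<Sum>\<^sub>\<infinity>n. f n x)"
  define G where "G = (\<lambda>x. \<Sum>\<^sub>\<infinity>n. f' n x)"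
  have cont': "continuous_on S (f' n)" for S n
    by (rule continuous_on_subset[OF cont subset_UNIV])
  have G: "continuous_on S G" for S
  proof (rule uniform_limit_theorem)
    show "uniform_limit S (\<lambda>A x. \<Sum>n\<in>A. f' n x) G (finite_subsets_at_top UNIV)"
      unfolding G_def by (rule Weierstrass_m_test_general[OF bound M])
    show "\<forall>\<^sub>F A in finite_subsets_at_top UNIV. continuous_on S (\<lambda>x. \<Sum>n\<in>A. f' n x)"
      by (intro always_eventually allI continuous_on_sum cont')
  qed simp
  have F: "(G has_integral F b - F a) {a..b}" if ab: "a \<le> b" for a b
  proof -
    have "(f' n has_integral f n b - f n a) {a..b}" for n
      by (rule fundamental_theorem_of_calculus[OF ab has_vector_derivative_at_within[OF deriv]])
    from has_integral_infsum[OF cont' bound M this] show ?thesis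
      using infsum_add[of "\<lambda>n. f n b" UNIV "\<lambda>n. - f n a"] summable
      by (simp add: F_def G_def infsum_uminus summable_on_uminus)
  qed
  have "((\<lambda>y. integral {x - 1..y} G) has_vector_derivative G x) (at x within {x - 1..x + 1})"
    by (rule integral_has_vector_derivative[OF G]) auto
  from has_vector_derivative_add[OF has_vector_derivative_const this]
  have "((\<lambda>y. F (x - 1) + integral {x - 1..y} G) has_vector_derivative G x)
      (at x within {x - 1..x + 1})" by simp
  then have "(F has_vector_derivative G x) (at x within {x - 1..x + 1})"
    by (rule has_vector_derivative_transform[rotated 2])
      (simp_all add: integral_unique[OF F])
  then show ?thesis
    by (simp add: at_within_Icc_at F_def G_def)
qed

text \<open>After multiplication by \<open>W_power (- m)\<close> the series is integrated term by
  term, and orthogonality leaves only the term \<open>n = m\<close>.\<close>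

lemma fourier_coeff_infsum:
  assumes "(\<lambda>n. norm (c n u)) summable_on UNIV"
  shows "fourier_coeff (\<lambda>u t. \<Sum>\<^sub>\<infinity>n. c n u * W_power n t) m u = c m u"
proof -
  have s: "(\<lambda>n. c n u * W_power n t) summable_on UNIV" for t
    using assms by (simp add: norm_mult abs_summable_summable)
  have eq: "(\<Sum>\<^sub>\<infinity>n. c n u * W_power n t) * W_power (- m) t = (\<Sum>\<^sub>\<infinity>n. c n u * W_power (n - m) t)" for t
    using W_power_add[of _ "- m" t] s[of t] by (simp add: mult.assoc flip: infsum_cmult_left)
  have "(W_power k has_integral (if k = 0 then 1 else 0)) {0..1}" for k
    using integrable_integral[OF integrable_continuous_real[OF continuous_on_W_power]]
    by (metis integral_W_power)
  then have "((\<lambda>t. c n u * W_power (n - m) t) has_integral c n u * (if n - m = 0 then 1 else 0)) {0..1}" for n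
    by (rule has_integral_mult_right)
  then have "((\<lambda>t. \<Sum>\<^sub>\<infinity>n. c n u * W_power (n - m) t) has_integral
      (\<Sum>\<^sub>\<infinity>n. c n u * (if n - m = 0 then 1 else 0))) {0..1}"
    by (intro has_integral_infsum[OF _ _ assms] continuous_intros) (simp_all add: norm_mult)
  moreover have "(\<Sum>\<^sub>\<infinity>n. c n u * (if n - m = 0 then 1 else 0)) = c m u"
    by (intro infsumI has_sum_finite_neutralI[of "{m}"]) auto
  ultimately show ?thesis by (simp add: fourier_coeff_def eq integral_unique)
qed

text \<open>Of the \<open>b + 2\<close> powers, \<open>b\<close> are kept to absorb polynomial
  weights and two make the series over \<open>n\<close> converge.\<close>

lemma fourier_coeff_bound:
  assumes "f \<in> schwartz_cyl"
  obtains C where "0 \<le> C" "\<And>n u. norm (fourier_coeff f n u) \<le> C * (1 / (1 + \<bar>real_of_int n\<bar>) ^ (b + 2))"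
proof -
  obtain C where C: "\<And>n u. (1 + \<bar>real_of_int n\<bar>) ^ (b + 2) * norm (fourier_coeff f n u) \<le> C"
    using fourier_coeff_decay[OF assms] by blast
  show ?thesis
  proof
    show "0 \<le> C" by (rule order_trans[OF _ C[of 0 0]]) simp
    show "norm (fourier_coeff f n u) \<le> C * (1 / (1 + \<bar>real_of_int n\<bar>) ^ (b + 2))" for n u
      using C[of n u] by (simp add: pos_le_divide_eq mult.commute del: power_add)
  qed
qed

section \<open>The Schwartz space of the module\<close>

text \<open>The weights \<open>1 + \<bar>x\<bar>\<close> and \<open>1 + \<bar>k\<bar>\<close> are at
  least 1 and behave submultiplicatively under shifts, unlike the monomials in
  \<open>schwartz_mod\<close>. Derivatives are treated separately.\<close>

definition rapid_decay :: "mod_fun \<Rightarrow> bool" where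
  "rapid_decay \<xi> \<longleftrightarrow> (\<forall>a b. \<exists>C. \<forall>x k.
     (1 + \<bar>x\<bar>) ^ a * (1 + \<bar>real_of_int k\<bar>) ^ b * norm (\<xi> x k) \<le> C)"

lemma one_plus_power_le:
  assumes "0 \<le> (y::real)"
  shows "(1 + y) ^ a \<le> 2 ^ a * (1 + y ^ a)"
proof -
  have "(1 + y) ^ a \<le> (2 * max 1 y) ^ a"
    using assms by (intro power_mono) auto
  also have "\<dots> = 2 ^ a * max 1 y ^ a" by (simp add: power_mult_distrib)
  also have "\<dots> \<le> 2 ^ a * (1 + y ^ a)"
    using assms by (intro mult_left_mono) (auto simp: max_def)
  finally show ?thesis .
qed

text \<open>Monomials are dominated by the weights. Conversely, bounding each weight by
  \<open>one_plus_power_le\<close> and multiplying out leaves the four monomials with exponents 0 or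
  \<open>a\<close> in \<open>x\<close> and 0 or \<open>b\<close> in \<open>k\<close>.\<close>

lemma rapid_decay_iff:
  "rapid_decay \<xi> \<longleftrightarrow>
    (\<forall>a b. \<exists>C. \<forall>x k. \<bar>x\<bar> ^ a * \<bar>real_of_int k\<bar> ^ b * norm (\<xi> x k) \<le> C)" (is "_ \<longleftrightarrow> ?R")
proof
  assume rd: "rapid_decay \<xi>"
  show ?R
  proof (intro allI)
    fix a b
    obtain C where C: "\<And>x k. (1 + \<bar>x\<bar>) ^ a * (1 + \<bar>real_of_int k\<bar>) ^ b * norm (\<xi> x k) \<le> C"
      using rd unfolding rapid_decay_def by meson
    have "\<bar>x\<bar> ^ a * \<bar>real_of_int k\<bar> ^ b * norm (\<xi> x k)
        \<le> (1 + \<bar>x\<bar>) ^ a * (1 + \<bar>real_of_int k\<bar>) ^ b * norm (\<xi> x k)" for x k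
      by (intro mult_right_mono mult_mono power_mono) auto
    then show "\<exists>C. \<forall>x k. \<bar>x\<bar> ^ a * \<bar>real_of_int k\<bar> ^ b * norm (\<xi> x k) \<le> C"
      using C order_trans by blast
  qed
next
  assume R: ?R
  show "rapid_decay \<xi>"
    unfolding rapid_decay_def
  proof (intro allI)
    fix a b
    obtain C where C: "\<And>a b x k. \<bar>x\<bar> ^ a * \<bar>real_of_int k\<bar> ^ b * norm (\<xi> x k) \<le> C a b"
      using R by metis
    have "(1 + \<bar>x\<bar>) ^ a * (1 + \<bar>real_of_int k\<bar>) ^ b * norm (\<xi> x k)
        \<le> 2 ^ a * 2 ^ b * (C 0 0 + C a 0 + C 0 b + C a b)" for x k
    proof -
      have "(1 + \<bar>x\<bar>) ^ a * (1 + \<bar>real_of_int k\<bar>) ^ b * norm (\<xi> x k)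
          \<le> (2 ^ a * (1 + \<bar>x\<bar> ^ a)) * (2 ^ b * (1 + \<bar>real_of_int k\<bar> ^ b)) * norm (\<xi> x k)"
        by (intro mult_right_mono mult_mono one_plus_power_le) auto
      also have "\<dots> = 2 ^ a * 2 ^ b * (norm (\<xi> x k) + \<bar>x\<bar> ^ a * norm (\<xi> x k)
          + \<bar>real_of_int k\<bar> ^ b * norm (\<xi> x k) + \<bar>x\<bar> ^ a * \<bar>real_of_int k\<bar> ^ b * norm (\<xi> x k))"
        by (simp add: algebra_simps)
      also have "\<dots> \<le> 2 ^ a * 2 ^ b * (C 0 0 + C a 0 + C 0 b + C a b)"
        using C[of x 0 k 0] C[of x a k 0] C[of x 0 k b] C[of x a k b]
        by (intro mult_left_mono add_mono) simp_all
      finally show ?thesis .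
    qed
    then show "\<exists>C. \<forall>x k. (1 + \<bar>x\<bar>) ^ a * (1 + \<bar>real_of_int k\<bar>) ^ b * norm (\<xi> x k) \<le> C"
      by blast
  qed
qed

lemma rapid_decayE:
  assumes "rapid_decay \<xi>"
  obtains C where "0 \<le> C"
    "\<And>x k. (1 + \<bar>x\<bar>) ^ a * (1 + \<bar>real_of_int k\<bar>) ^ b * norm (\<xi> x k) \<le> C"
proof -
  obtain C where C: "\<And>x k. (1 + \<bar>x\<bar>) ^ a * (1 + \<bar>real_of_int k\<bar>) ^ b * norm (\<xi> x k) \<le> C"
    using assms unfolding rapid_decay_def by meson
  moreover have "0 \<le> C" by (rule order_trans[OF _ C[of 0 0]]) simp
  ultimately show ?thesis using that by blast
qed

lemma rapid_decay_add:
  assumes "rapid_decay \<xi>" "rapid_decay \<eta>"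
  shows "rapid_decay (\<lambda>x k. \<xi> x k + \<eta> x k)"
  unfolding rapid_decay_def
proof (intro allI)
  fix a b
  let ?w = "\<lambda>x k. (1 + \<bar>x\<bar>) ^ a * (1 + \<bar>real_of_int k\<bar>) ^ b"
  obtain C where C: "\<And>x k. ?w x k * norm (\<xi> x k) \<le> C" using rapid_decayE[OF assms(1)] by metis
  obtain D where D: "\<And>x k. ?w x k * norm (\<eta> x k) \<le> D" using rapid_decayE[OF assms(2)] by metis
  have "?w x k * norm (\<xi> x k + \<eta> x k) \<le> C + D" for x k
  proof -
    have "?w x k * norm (\<xi> x k + \<eta> x k) \<le> ?w x k * (norm (\<xi> x k) + norm (\<eta> x k))"
      by (intro mult_left_mono norm_triangle_ineq) simp
    also have "\<dots> \<le> C + D" unfolding distrib_left by (intro add_mono C D)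
    finally show ?thesis .
  qed
  then show "\<exists>C. \<forall>x k. ?w x k * norm (\<xi> x k + \<eta> x k) \<le> C" by blast
qed

text \<open>Polynomial growth is absorbed by testing \<xi> with the larger exponents
  \<open>a + p\<close> and \<open>b + q\<close>.\<close>

lemma rapid_decay_polynomial_bound:
  assumes "rapid_decay \<xi>"
    and le: "\<And>x k. norm (\<eta> x k) \<le> K * ((1 + \<bar>x\<bar>) ^ p * (1 + \<bar>real_of_int k\<bar>) ^ q * norm (\<xi> x k))"
  shows "rapid_decay \<eta>"
  unfolding rapid_decay_def
proof (intro allI)
  fix a b
  obtain C where C: "0 \<le> C" "\<And>x k. (1 + \<bar>x\<bar>) ^ (a + p) * (1 + \<bar>real_of_int k\<bar>) ^ (b + q) * norm (\<xi> x k) \<le> C"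
    using rapid_decayE[OF assms(1)] by metis
  have "(1 + \<bar>x\<bar>) ^ a * (1 + \<bar>real_of_int k\<bar>) ^ b * norm (\<eta> x k) \<le> \<bar>K\<bar> * C" for x k
  proof -
    have "(1 + \<bar>x\<bar>) ^ a * (1 + \<bar>real_of_int k\<bar>) ^ b * norm (\<eta> x k)
        \<le> (1 + \<bar>x\<bar>) ^ a * (1 + \<bar>real_of_int k\<bar>) ^ b *
          (K * ((1 + \<bar>x\<bar>) ^ p * (1 + \<bar>real_of_int k\<bar>) ^ q * norm (\<xi> x k)))"
      by (intro mult_left_mono le) simp
    also have "\<dots> = K * ((1 + \<bar>x\<bar>) ^ (a + p) * (1 + \<bar>real_of_int k\<bar>) ^ (b + q) * norm (\<xi> x k))"
      by (simp add: power_add mult_ac)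
    also have "\<dots> \<le> \<bar>K\<bar> * C"
      by (intro mult_mono C) simp_all
    finally show ?thesis .
  qed
  then show "\<exists>C. \<forall>x k. (1 + \<bar>x\<bar>) ^ a * (1 + \<bar>real_of_int k\<bar>) ^ b * norm (\<eta> x k) \<le> C" by blast
qed

lemma rapid_decay_cmult: "rapid_decay \<xi> \<Longrightarrow> rapid_decay (\<lambda>x k. c * \<xi> x k)"
  by (erule rapid_decay_polynomial_bound[of _ _ "norm c" 0 0]) (simp add: norm_mult)

lemma rapid_decay_mult_x: "rapid_decay \<xi> \<Longrightarrow> rapid_decay (\<lambda>x k. of_real x * \<xi> x k)"
  by (erule rapid_decay_polynomial_bound[of _ _ 1 1 0]) (simp add: norm_mult mult_right_mono)

lemma rapid_decay_mult_k: "rapid_decay \<xi> \<Longrightarrow> rapid_decay (\<lambda>x k. of_int k * \<xi> x k)"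
  by (erule rapid_decay_polynomial_bound[of _ _ 1 0 1]) (simp add: norm_mult mult_right_mono)

section \<open>Closure properties of the Schwartz space\<close>

lemma schwartz_mod_iff:
  "\<xi> \<in> schwartz_mod \<longleftrightarrow> (\<forall>m. rapid_decay ((partial_x ^^ m) \<xi>) \<and>
     (\<forall>k x. (\<lambda>y. (partial_x ^^ m) \<xi> y k) differentiable (at x)))"
  by (auto simp: schwartz_mod_def rapid_decay_iff)

text \<open>\<open>schwartz_mod\<close> is the largest set of differentiable, rapidly decaying
  functions that is stable under \<open>partial_x\<close>. Exhibiting a stable set replaces formulas
  for higher derivatives.\<close>

lemma schwartz_mod_coinduct:
  assumes "\<xi> \<in> S"
    and decay: "\<And>\<xi>. \<xi> \<in> S \<Longrightarrow> rapid_decay \<xi>"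
    and diff: "\<And>\<xi> k x. \<xi> \<in> S \<Longrightarrow> (\<lambda>y. \<xi> y k) differentiable (at x)"
    and closed: "\<And>\<xi>. \<xi> \<in> S \<Longrightarrow> partial_x \<xi> \<in> S"
  shows "\<xi> \<in> schwartz_mod"
proof -
  have "(partial_x ^^ m) \<xi> \<in> S" for m
    using assms(1) by (induction m) (simp_all add: closed)
  then show ?thesis by (simp add: schwartz_mod_iff decay diff)
qed

lemma schwartz_mod_decay: "\<xi> \<in> schwartz_mod \<Longrightarrow> rapid_decay \<xi>"
  unfolding schwartz_mod_iff by (metis funpow_0)

lemma schwartz_mod_differentiable:
  "\<xi> \<in> schwartz_mod \<Longrightarrow> (\<lambda>y. \<xi> y k) differentiable (at x)"
  unfolding schwartz_mod_iff by (metis funpow_0)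

lemma has_vector_derivative_partial_x:
  "\<xi> \<in> schwartz_mod \<Longrightarrow> ((\<lambda>y. \<xi> y k) has_vector_derivative partial_x \<xi> x k) (at x)"
  using schwartz_mod_differentiable by (simp add: partial_x_def vector_derivative_works)

lemma partial_x_eqI:
  assumes "\<And>x k. ((\<lambda>y. \<xi> y k) has_vector_derivative \<eta> x k) (at x)"
  shows "partial_x \<xi> = \<eta>"
  using assms by (simp add: partial_x_def fun_eq_iff vector_derivative_at)

lemma schwartz_mod_partial_x: "\<xi> \<in> schwartz_mod \<Longrightarrow> partial_x \<xi> \<in> schwartz_mod"
  unfolding schwartz_mod_iff by (metis comp_apply funpow_Suc_right)

lemma schwartz_mod_add:
  assumes "\<xi> \<in> schwartz_mod" "\<eta> \<in> schwartz_mod"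
  shows "(\<lambda>x k. \<xi> x k + \<eta> x k) \<in> schwartz_mod"
proof (rule schwartz_mod_coinduct)
  let ?S = "{\<lambda>x k. \<xi> x k + \<eta> x k | \<xi> \<eta>. \<xi> \<in> schwartz_mod \<and> \<eta> \<in> schwartz_mod}"
  show "(\<lambda>x k. \<xi> x k + \<eta> x k) \<in> ?S" using assms by blast
  fix \<zeta> assume "\<zeta> \<in> ?S"
  then obtain \<xi> \<eta> where \<zeta>: "\<zeta> = (\<lambda>x k. \<xi> x k + \<eta> x k)" and s: "\<xi> \<in> schwartz_mod" "\<eta> \<in> schwartz_mod"
    by blast
  show "rapid_decay \<zeta>" unfolding \<zeta> by (intro rapid_decay_add schwartz_mod_decay s)
  have d: "((\<lambda>y. \<zeta> y k) has_vector_derivative partial_x \<xi> x k + partial_x \<eta> x k) (at x)" for x k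
    unfolding \<zeta> by (intro has_vector_derivative_add has_vector_derivative_partial_x s)
  then show "(\<lambda>y. \<zeta> y k) differentiable (at x)" for k x by (rule differentiableI_vector)
  have "partial_x \<zeta> = (\<lambda>x k. partial_x \<xi> x k + partial_x \<eta> x k)"
    using d by (rule partial_x_eqI)
  with s show "partial_x \<zeta> \<in> ?S" using schwartz_mod_partial_x by blast
qed

lemma schwartz_mod_cmult:
  assumes "\<xi> \<in> schwartz_mod"
  shows "(\<lambda>x k. c * \<xi> x k) \<in> schwartz_mod"
proof (rule schwartz_mod_coinduct)
  let ?S = "{\<lambda>x k. c * \<xi> x k | \<xi>. \<xi> \<in> schwartz_mod}"
  show "(\<lambda>x k. c * \<xi> x k) \<in> ?S" using assms by blast
  fix \<zeta> assume "\<zeta> \<in> ?S"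
  then obtain \<xi> where \<zeta>: "\<zeta> = (\<lambda>x k. c * \<xi> x k)" and s: "\<xi> \<in> schwartz_mod" by blast
  show "rapid_decay \<zeta>" unfolding \<zeta> by (intro rapid_decay_cmult schwartz_mod_decay s)
  have d: "((\<lambda>y. \<zeta> y k) has_vector_derivative c * partial_x \<xi> x k) (at x)" for x k
    unfolding \<zeta> by (intro has_vector_derivative_mult_right has_vector_derivative_partial_x s)
  then show "(\<lambda>y. \<zeta> y k) differentiable (at x)" for k x by (rule differentiableI_vector)
  have "partial_x \<zeta> = (\<lambda>x k. c * partial_x \<xi> x k)" using d by (rule partial_x_eqI)
  with s show "partial_x \<zeta> \<in> ?S" using schwartz_mod_partial_x by blast
qed

lemma schwartz_mod_mult_k:
  assumes "\<xi> \<in> schwartz_mod"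
  shows "(\<lambda>x k. of_int k * \<xi> x k) \<in> schwartz_mod"
proof (rule schwartz_mod_coinduct)
  let ?S = "{\<lambda>x k. of_int k * \<xi> x k | \<xi>. \<xi> \<in> schwartz_mod}"
  show "(\<lambda>x k. of_int k * \<xi> x k) \<in> ?S" using assms by blast
  fix \<zeta> assume "\<zeta> \<in> ?S"
  then obtain \<xi> where \<zeta>: "\<zeta> = (\<lambda>x k. of_int k * \<xi> x k)" and s: "\<xi> \<in> schwartz_mod" by blast
  show "rapid_decay \<zeta>" unfolding \<zeta> by (intro rapid_decay_mult_k schwartz_mod_decay s)
  have d: "((\<lambda>y. \<zeta> y k) has_vector_derivative of_int k * partial_x \<xi> x k) (at x)" for x k
    unfolding \<zeta> by (intro has_vector_derivative_mult_right has_vector_derivative_partial_x s)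
  then show "(\<lambda>y. \<zeta> y k) differentiable (at x)" for k x by (rule differentiableI_vector)
  have "partial_x \<zeta> = (\<lambda>x k. of_int k * partial_x \<xi> x k)" using d by (rule partial_x_eqI)
  with s show "partial_x \<zeta> \<in> ?S" using schwartz_mod_partial_x by blast
qed

lemma schwartz_mod_mult_x:
  assumes "\<xi> \<in> schwartz_mod"
  shows "(\<lambda>x k. of_real x * \<xi> x k) \<in> schwartz_mod"
proof (rule schwartz_mod_coinduct)
  \<comment> \<open>Differentiating the product with \<open>x\<close> produces the extra term \<xi>,
    so the stable set has to allow a Schwartz summand; it starts out as 0.\<close>
  let ?S = "{\<lambda>x k. of_real x * \<xi> x k + \<eta> x k | \<xi> \<eta>. \<xi> \<in> schwartz_mod \<and> \<eta> \<in> schwartz_mod}"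
  have "(\<lambda>x k. 0) \<in> schwartz_mod" using schwartz_mod_cmult[OF assms, of 0] by simp
  then show "(\<lambda>x k. of_real x * \<xi> x k) \<in> ?S"
    using assms by (intro CollectI exI[of _ \<xi>] exI[of _ "\<lambda>x k. 0"]) simp
  fix \<zeta> assume "\<zeta> \<in> ?S"
  then obtain \<xi> \<eta> where \<zeta>: "\<zeta> = (\<lambda>x k. of_real x * \<xi> x k + \<eta> x k)"
    and s: "\<xi> \<in> schwartz_mod" "\<eta> \<in> schwartz_mod" by blast
  show "rapid_decay \<zeta>"
    unfolding \<zeta> by (intro rapid_decay_add rapid_decay_mult_x schwartz_mod_decay s)
  have d: "((\<lambda>y. \<zeta> y k) has_vector_derivative of_real x * partial_x \<xi> x k + (\<xi> x k + partial_x \<eta> x k)) (at x)"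
    for x k
  proof -
    have "((\<lambda>y. \<zeta> y k) has_vector_derivative
        (of_real x * partial_x \<xi> x k + of_real 1 * \<xi> x k) + partial_x \<eta> x k) (at x)"
      unfolding \<zeta> by (intro has_vector_derivative_add has_vector_derivative_mult
        has_vector_derivative_of_real DERIV_ident has_vector_derivative_partial_x s)
    then show ?thesis by (simp add: add.assoc)
  qed
  then show "(\<lambda>y. \<zeta> y k) differentiable (at x)" for k x by (rule differentiableI_vector)
  have "partial_x \<zeta> = (\<lambda>x k. of_real x * partial_x \<xi> x k + (\<xi> x k + partial_x \<eta> x k))"
    using d by (rule partial_x_eqI)
  moreover have "(\<lambda>x k. \<xi> x k + partial_x \<eta> x k) \<in> schwartz_mod"
    by (intro schwartz_mod_add schwartz_mod_partial_x s)
  ultimately show "partial_x \<zeta> \<in> ?S"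
    using schwartz_mod_partial_x[OF s(1)]
    by (intro CollectI exI[of _ "partial_x \<xi>"] exI[of _ "\<lambda>x k. \<xi> x k + partial_x \<eta> x k"]) simp
qed

section \<open>The module action\<close>

text \<open>A Peetre-type inequality: the weight at \<open>x\<close> is at most the weight at the
  shifted point times that of the shift \<open>y\<close>. Below, \<open>y\<close> is a multiple of
  \<open>n\<close> and \<open>z\<close> is the absolute value of \<open>n\<close>.\<close>

lemma one_plus_abs_le_mult:
  assumes "norm y \<le> c * z" "0 \<le> c" "0 \<le> (z::real)"
  shows "1 + \<bar>x::real\<bar> \<le> (1 + \<bar>x - y\<bar>) * ((1 + c) * (1 + z))"
proof -
  have "1 + \<bar>x\<bar> \<le> (1 + \<bar>x - y\<bar>) * (1 + \<bar>y\<bar>)"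
    by (simp add: algebra_simps) (smt (verit, best) mult_nonneg_nonneg abs_ge_zero)
  also have "\<dots> \<le> (1 + \<bar>x - y\<bar>) * ((1 + c) * (1 + z))"
    using assms by (intro mult_left_mono) (auto simp: algebra_simps)
  finally show ?thesis .
qed

text \<open>The shift by \<open>n\<close> steps costs a factor polynomial in \<open>n\<close>, which the decay of the
  Fourier coefficients absorbs.\<close>

lemma mod_action_term_bound:
  assumes f: "f \<in> schwartz_cyl" and \<xi>: "rapid_decay \<xi>"
  obtains C where "\<And>n u x k. (1 + \<bar>x\<bar>) ^ a * (1 + \<bar>real_of_int k\<bar>) ^ b *
      norm (fourier_coeff f n u * \<xi> (x - of_int n * \<epsilon>) (k - n * r))
    \<le> C * (1 / (1 + \<bar>real_of_int n\<bar>) ^ 2)"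
proof -
  define e s where "e = 1 + \<bar>\<epsilon>\<bar>" and "s = 1 + \<bar>real_of_int r\<bar>"
  \<comment> \<open>The shift in \<open>x\<close> costs \<open>a\<close> powers of
    \<open>1 + \<bar>n\<bar>\<close> and the shift in \<open>k\<close> costs \<open>b\<close>; two
    remain for convergence.\<close>
  obtain C where C: "0 \<le> C" "\<And>n u. norm (fourier_coeff f n u) \<le> C * (1 / (1 + \<bar>real_of_int n\<bar>) ^ ((a + b) + 2))"
    using fourier_coeff_bound[OF f] by metis
  obtain D where D: "0 \<le> D" "\<And>x k. (1 + \<bar>x\<bar>) ^ a * (1 + \<bar>real_of_int k\<bar>) ^ b * norm (\<xi> x k) \<le> D"
    using rapid_decayE[OF \<xi>] by metis
  have es: "0 \<le> e" "0 \<le> s" by (auto simp: e_def s_def)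
  have "(1 + \<bar>x\<bar>) ^ a * (1 + \<bar>real_of_int k\<bar>) ^ b *
      norm (fourier_coeff f n u * \<xi> (x - of_int n * \<epsilon>) (k - n * r))
    \<le> (e ^ a * s ^ b * C * D) * (1 / (1 + \<bar>real_of_int n\<bar>) ^ 2)" for n u x k
  proof -
    define N where "N = 1 + \<bar>real_of_int n\<bar>"
    define X where "X = 1 + \<bar>x - of_int n * \<epsilon>\<bar>"
    define K where "K = 1 + \<bar>real_of_int (k - n * r)\<bar>"
    define z where "z = norm (\<xi> (x - of_int n * \<epsilon>) (k - n * r))"
    have pos: "N > 0" "X > 0" "K > 0" "z \<ge> 0" by (auto simp: N_def X_def K_def z_def)
    have "1 + \<bar>x\<bar> \<le> X * (e * N)"
      unfolding X_def e_def N_def by (rule one_plus_abs_le_mult) (auto simp: abs_mult)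
    moreover have "1 + \<bar>real_of_int k\<bar> \<le> K * (s * N)"
      using one_plus_abs_le_mult[of "of_int n * of_int r" "\<bar>real_of_int r\<bar>" "\<bar>real_of_int n\<bar>" "of_int k"]
      unfolding K_def s_def N_def by (simp add: abs_mult)
    ultimately have "(1 + \<bar>x\<bar>) ^ a * (1 + \<bar>real_of_int k\<bar>) ^ b * (norm (fourier_coeff f n u) * z)
        \<le> (X * (e * N)) ^ a * (K * (s * N)) ^ b * (C * (1 / N ^ ((a + b) + 2)) * z)"
      using C pos es unfolding N_def by (intro mult_mono power_mono) auto
    also have "\<dots> = e ^ a * s ^ b * C * (1 / N ^ 2) * (X ^ a * K ^ b * z)"
      using pos by (simp add: power_mult_distrib power_add power2_eq_square field_simps)
    also have "\<dots> \<le> e ^ a * s ^ b * C * (1 / N ^ 2) * D"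
      using D(2)[of "x - of_int n * \<epsilon>" "k - n * r"] C(1) es unfolding X_def K_def z_def by (intro mult_left_mono) auto
    finally show ?thesis by (simp add: N_def z_def norm_mult mult_ac)
  qed
  then show ?thesis by (rule that)
qed

text \<open>The case of trivial weights. As \<open>u\<close> is independent of \<open>x\<close> and
  \<open>k\<close>, this majorizes the action series uniformly.\<close>

lemma mod_action_term_uniform:
  assumes f: "f \<in> schwartz_cyl" and \<xi>: "rapid_decay \<xi>"
  obtains C where "\<And>n u x k. norm (fourier_coeff f n u * \<xi> (x - of_int n * \<epsilon>) (k - n * r))
    \<le> C * (1 / (1 + \<bar>real_of_int n\<bar>) ^ 2)"
proof -
  obtain C where "\<And>n u x k. (1 + \<bar>x\<bar>) ^ 0 * (1 + \<bar>real_of_int k\<bar>) ^ 0 *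
      norm (fourier_coeff f n u * \<xi> (x - of_int n * \<epsilon>) (k - n * r))
    \<le> C * (1 / (1 + \<bar>real_of_int n\<bar>) ^ 2)"
    using mod_action_term_bound[OF assms, where a = 0 and b = 0] by blast
  then show ?thesis by (intro that) simp
qed

lemma mod_action_abs_summable:
  assumes "f \<in> schwartz_cyl" "rapid_decay \<xi>"
  shows "(\<lambda>n. norm (fourier_coeff f n (u n) * \<xi> (x - of_int n * \<epsilon>) (k - n * r))) summable_on UNIV"
proof -
  obtain C where C: "\<And>n u x k. norm (fourier_coeff f n u * \<xi> (x - of_int n * \<epsilon>) (k - n * r))
      \<le> C * (1 / (1 + \<bar>real_of_int n\<bar>) ^ 2)"
    using mod_action_term_uniform[OF assms] by metis
  show ?thesis
    by (rule Infinite_Sum.abs_summable_on_comparison_test'[OF summable_on_cmult_right[OF summable_on_int_inverse_square]])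
      (rule C)
qed

lemma mod_action_summable:
  assumes "f \<in> schwartz_cyl" "rapid_decay \<xi>"
  shows "(\<lambda>n. fourier_coeff f n (u n) * \<xi> (x - of_int n * \<epsilon>) (k - n * r)) summable_on UNIV"
  using mod_action_abs_summable[OF assms] by (rule abs_summable_summable)

lemma rapid_decay_mod_action:
  assumes "f \<in> schwartz_cyl" "rapid_decay \<xi>"
  shows "rapid_decay (mod_action l0 l1 \<epsilon> r f \<xi>)"
  unfolding rapid_decay_def
proof (intro allI)
  fix a b
  let ?w = "\<lambda>x k. (1 + \<bar>x\<bar>) ^ a * (1 + \<bar>real_of_int k\<bar>) ^ b"
  obtain C where C: "\<And>n u x k. ?w x k * norm (fourier_coeff f n u * \<xi> (x - of_int n * \<epsilon>) (k - n * r))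
      \<le> C * (1 / (1 + \<bar>real_of_int n\<bar>) ^ 2)"
    using mod_action_term_bound[OF assms] by metis
  have "?w x k * norm (mod_action l0 l1 \<epsilon> r f \<xi> x k)
      \<le> (\<Sum>\<^sub>\<infinity>n::int. C * (1 / (1 + \<bar>real_of_int n\<bar>) ^ 2))" for x k
  proof -
    let ?t = "\<lambda>n. norm (fourier_coeff f n (l0 * x + l1 * of_int k) * \<xi> (x - of_int n * \<epsilon>) (k - n * r))"
    have s: "?t summable_on UNIV" by (rule mod_action_abs_summable[OF assms])
    have "?w x k * norm (mod_action l0 l1 \<epsilon> r f \<xi> x k) \<le> ?w x k * (\<Sum>\<^sub>\<infinity>n. ?t n)"
      unfolding mod_action_def by (intro mult_left_mono norm_infsum_bound s) simp
    also have "\<dots> = (\<Sum>\<^sub>\<infinity>n. ?w x k * ?t n)"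
      by (rule infsum_cmult_right[OF s, symmetric])
    also have "\<dots> \<le> (\<Sum>\<^sub>\<infinity>n::int. C * (1 / (1 + \<bar>real_of_int n\<bar>) ^ 2))"
      by (intro infsum_mono summable_on_cmult_right s summable_on_int_inverse_square C)
    finally show ?thesis .
  qed
  then show "\<exists>C. \<forall>x k. ?w x k * norm (mod_action l0 l1 \<epsilon> r f \<xi> x k) \<le> C" by blast
qed

section \<open>Differentiating the action in \<open>x\<close>\<close>

lemma has_vector_derivative_compose_affine:
  fixes g :: "real \<Rightarrow> complex"
  assumes "\<And>y. (g has_vector_derivative g' y) (at y)"
  shows "((\<lambda>x. g (m * x + c)) has_vector_derivative of_real m * g' (m * x + c)) (at x)"
proof -
  have "((g \<circ> (\<lambda>x. m * x + c)) has_vector_derivative m *\<^sub>R g' (m * x + c)) (at x)"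
    by (rule vector_diff_chain_at[OF _ assms]) (auto intro!: derivative_eq_intros)
  then show ?thesis by (simp add: o_def scaleR_conv_of_real)
qed

text \<open>The product rule in each term gives terms of two further action series, those of
  \<open>partial_u f\<close> on \<xi>, with the inner factor \<open>l0\<close>, and of
  \<open>f\<close> on \<open>partial_x \<xi>\<close>. Both have summable majorants.\<close>

lemma mod_action_has_vector_derivative:
  assumes f: "f \<in> schwartz_cyl" and \<xi>: "\<xi> \<in> schwartz_mod"
  shows "((\<lambda>x. mod_action l0 l1 \<epsilon> r f \<xi> x k) has_vector_derivative
    of_real l0 * mod_action l0 l1 \<epsilon> r (partial_u f) \<xi> x k + mod_action l0 l1 \<epsilon> r f (partial_x \<xi>) x k) (at x)"
proof -
  note f' = partial_u_schwartz_cyl[OF f] and \<xi>' = schwartz_mod_partial_x[OF \<xi>]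
  let ?t = "\<lambda>f \<xi> n x. fourier_coeff f n (l0 * x + l1 * of_int k) * \<xi> (x - of_int n * \<epsilon>) (k - n * r)"
  \<comment> \<open>Stated for arbitrary \<open>f\<close> and \<xi>, because it is applied again to
    the terms of the differentiated series to get their continuity.\<close>
  have deriv: "(?t f \<xi> n has_vector_derivative of_real l0 * ?t (partial_u f) \<xi> n x + ?t f (partial_x \<xi>) n x) (at x)"
    if f: "f \<in> schwartz_cyl" and \<xi>: "\<xi> \<in> schwartz_mod" for f \<xi> n x
  proof -
    have "((\<lambda>x. \<xi> (1 * x + - (of_int n * \<epsilon>)) (k - n * r)) has_vector_derivative
        of_real 1 * partial_x \<xi> (1 * x + - (of_int n * \<epsilon>)) (k - n * r)) (at x)"
      by (intro has_vector_derivative_compose_affine has_vector_derivative_partial_x \<xi>)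
    then have "((\<lambda>x. \<xi> (x - of_int n * \<epsilon>) (k - n * r)) has_vector_derivative
        partial_x \<xi> (x - of_int n * \<epsilon>) (k - n * r)) (at x)" by simp
    from has_vector_derivative_mult[OF
        has_vector_derivative_compose_affine[OF fourier_coeff_has_vector_derivative[OF f],
          where m = l0 and c = "l1 * of_int k"] this]
    show ?thesis by (simp add: add_ac mult_ac)
  qed
  obtain C where C: "\<And>n u x k. norm (fourier_coeff (partial_u f) n u * \<xi> (x - of_int n * \<epsilon>) (k - n * r))
      \<le> C * (1 / (1 + \<bar>real_of_int n\<bar>) ^ 2)"
    using mod_action_term_uniform[OF f' schwartz_mod_decay[OF \<xi>]] by metis
  obtain D where D: "\<And>n u x k. norm (fourier_coeff f n u * partial_x \<xi> (x - of_int n * \<epsilon>) (k - n * r))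
      \<le> D * (1 / (1 + \<bar>real_of_int n\<bar>) ^ 2)"
    using mod_action_term_uniform[OF f schwartz_mod_decay[OF \<xi>']] by metis
  have "((\<lambda>x. \<Sum>\<^sub>\<infinity>n. ?t f \<xi> n x) has_vector_derivative
      (\<Sum>\<^sub>\<infinity>n. of_real l0 * ?t (partial_u f) \<xi> n x + ?t f (partial_x \<xi>) n x)) (at x)"
  proof (rule infsum_has_vector_derivative)
    show "(?t f \<xi> n has_vector_derivative of_real l0 * ?t (partial_u f) \<xi> n x + ?t f (partial_x \<xi>) n x) (at x)" for n x
      by (rule deriv[OF f \<xi>])
    show "continuous_on UNIV (\<lambda>x. of_real l0 * ?t (partial_u f) \<xi> n x + ?t f (partial_x \<xi>) n x)" for n
      by (intro continuous_on_add continuous_on_mult_left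
          continuous_on_vector_derivative[OF deriv[OF f' \<xi>]]
          continuous_on_vector_derivative[OF deriv[OF f \<xi>']])
    show "norm (of_real l0 * ?t (partial_u f) \<xi> n x + ?t f (partial_x \<xi>) n x)
        \<le> (\<bar>l0\<bar> * C + D) * (1 / (1 + \<bar>real_of_int n\<bar>) ^ 2)" for n x
    proof -
      have "norm (of_real l0 * ?t (partial_u f) \<xi> n x) \<le> \<bar>l0\<bar> * (C * (1 / (1 + \<bar>real_of_int n\<bar>) ^ 2))"
        unfolding norm_mult[of "of_real l0"] norm_of_real by (intro mult_left_mono C) simp
      from norm_triangle_le[OF add_mono[OF this D[of n "l0 * x + l1 * of_int k" x k]]] show ?thesis
        by (simp add: distrib_right add_divide_distrib)
    qed
    show "(\<lambda>n::int. (\<bar>l0\<bar> * C + D) * (1 / (1 + \<bar>real_of_int n\<bar>) ^ 2)) summable_on UNIV"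
      by (rule summable_on_cmult_right[OF summable_on_int_inverse_square])
    show "(\<lambda>n. ?t f \<xi> n x) summable_on UNIV" for x
      by (rule mod_action_summable[OF f schwartz_mod_decay[OF \<xi>]])
  qed
  moreover have "(\<Sum>\<^sub>\<infinity>n. of_real l0 * ?t (partial_u f) \<xi> n x + ?t f (partial_x \<xi>) n x)
      = (\<Sum>\<^sub>\<infinity>n. of_real l0 * ?t (partial_u f) \<xi> n x) + (\<Sum>\<^sub>\<infinity>n. ?t f (partial_x \<xi>) n x)"
    by (intro infsum_add summable_on_cmult_right mod_action_summable f f' schwartz_mod_decay \<xi> \<xi>')
  moreover have "(\<Sum>\<^sub>\<infinity>n. of_real l0 * ?t (partial_u f) \<xi> n x) = of_real l0 * (\<Sum>\<^sub>\<infinity>n. ?t (partial_u f) \<xi> n x)"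
    by (intro infsum_cmult_right mod_action_summable f' schwartz_mod_decay \<xi>)
  ultimately show ?thesis by (simp add: mod_action_def)
qed

lemma partial_x_mod_action:
  assumes "f \<in> schwartz_cyl" "\<xi> \<in> schwartz_mod"
  shows "partial_x (mod_action l0 l1 \<epsilon> r f \<xi>) = (\<lambda>x k.
    of_real l0 * mod_action l0 l1 \<epsilon> r (partial_u f) \<xi> x k + mod_action l0 l1 \<epsilon> r f (partial_x \<xi>) x k)"
  by (rule partial_x_eqI[OF mod_action_has_vector_derivative[OF assms]])

text \<open>
  The \<open>x\<close>-derivative of \<open>f \<xi>\<close> is not of this form again, but the span of all such
  elements is closed under differentiation.
\<close>

inductive_set mod_action_span :: "real \<Rightarrow> real \<Rightarrow> real \<Rightarrow> int \<Rightarrow> mod_fun set"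
  for l0 l1 \<epsilon> :: real and r :: int where
  action: "f \<in> schwartz_cyl \<Longrightarrow> \<xi> \<in> schwartz_mod \<Longrightarrow> mod_action l0 l1 \<epsilon> r f \<xi> \<in> mod_action_span l0 l1 \<epsilon> r"
| add: "\<xi> \<in> mod_action_span l0 l1 \<epsilon> r \<Longrightarrow> \<eta> \<in> mod_action_span l0 l1 \<epsilon> r
    \<Longrightarrow> (\<lambda>x k. \<xi> x k + \<eta> x k) \<in> mod_action_span l0 l1 \<epsilon> r"
| cmult: "\<xi> \<in> mod_action_span l0 l1 \<epsilon> r \<Longrightarrow> (\<lambda>x k. c * \<xi> x k) \<in> mod_action_span l0 l1 \<epsilon> r"

lemma mod_action_span_decay: "\<xi> \<in> mod_action_span l0 l1 \<epsilon> r \<Longrightarrow> rapid_decay \<xi>"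
  by (induction rule: mod_action_span.induct)
    (simp_all add: rapid_decay_add rapid_decay_cmult rapid_decay_mod_action schwartz_mod_decay)

text \<open>Stability and differentiability are proved in one induction: computing
  \<open>partial_x\<close> of a sum or multiple requires that its constituents are
  differentiable.\<close>

lemma mod_action_span_deriv:
  assumes "\<zeta> \<in> mod_action_span l0 l1 \<epsilon> r"
  shows "partial_x \<zeta> \<in> mod_action_span l0 l1 \<epsilon> r \<and>
    (\<forall>x k. ((\<lambda>y. \<zeta> y k) has_vector_derivative partial_x \<zeta> x k) (at x))"
  using assms
proof induction
  case (action f \<xi>)
  then have "partial_x (mod_action l0 l1 \<epsilon> r f \<xi>) \<in> mod_action_span l0 l1 \<epsilon> r"
    unfolding partial_x_mod_action[OF action]
    by (intro mod_action_span.intros partial_u_schwartz_cyl schwartz_mod_partial_x)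
  then show ?case
    using mod_action_has_vector_derivative[OF action] by (simp add: partial_x_mod_action[OF action])
next
  case (add \<xi> \<eta>)
  then have d: "((\<lambda>y. \<xi> y k + \<eta> y k) has_vector_derivative partial_x \<xi> x k + partial_x \<eta> x k) (at x)" for x k
    by (intro has_vector_derivative_add) simp_all
  from partial_x_eqI[OF this]
  have eq: "partial_x (\<lambda>x k. \<xi> x k + \<eta> x k) = (\<lambda>x k. partial_x \<xi> x k + partial_x \<eta> x k)" .
  show ?case unfolding eq using d add by (simp add: mod_action_span.add)
next
  case (cmult \<xi> c)
  then have d: "((\<lambda>y. c * \<xi> y k) has_vector_derivative c * partial_x \<xi> x k) (at x)" for x k
    by (intro has_vector_derivative_mult_right) simp_all
  from partial_x_eqI[OF this]
  have eq: "partial_x (\<lambda>x k. c * \<xi> x k) = (\<lambda>x k. c * partial_x \<xi> x k)" .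
  show ?case unfolding eq using d cmult by (simp add: mod_action_span.cmult)
qed

lemma mod_action_schwartz_mod:
  assumes "f \<in> schwartz_cyl" "\<xi> \<in> schwartz_mod"
  shows "mod_action l0 l1 \<epsilon> r f \<xi> \<in> schwartz_mod"
proof (rule schwartz_mod_coinduct)
  show "mod_action l0 l1 \<epsilon> r f \<xi> \<in> mod_action_span l0 l1 \<epsilon> r"
    using assms by (rule mod_action_span.action)
qed (use mod_action_span_decay mod_action_span_deriv differentiableI_vector in blast)+

section \<open>Bilinearity of the action\<close>

lemma mod_action_add_left:
  assumes "f \<in> schwartz_cyl" "g \<in> schwartz_cyl" "\<xi> \<in> schwartz_mod"
  shows "mod_action l0 l1 \<epsilon> r (\<lambda>u t. f u t + g u t) \<xi>
    = (\<lambda>x k. mod_action l0 l1 \<epsilon> r f \<xi> x k + mod_action l0 l1 \<epsilon> r g \<xi> x k)"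
  unfolding mod_action_def fourier_coeff_add[OF assms(1,2)] distrib_right
  by (intro ext infsum_add mod_action_summable assms schwartz_mod_decay)

lemma mod_action_add_right:
  assumes "f \<in> schwartz_cyl" "\<xi> \<in> schwartz_mod" "\<eta> \<in> schwartz_mod"
  shows "mod_action l0 l1 \<epsilon> r f (\<lambda>x k. \<xi> x k + \<eta> x k)
    = (\<lambda>x k. mod_action l0 l1 \<epsilon> r f \<xi> x k + mod_action l0 l1 \<epsilon> r f \<eta> x k)"
  unfolding mod_action_def distrib_left
  by (intro ext infsum_add mod_action_summable assms schwartz_mod_decay)

lemma mod_action_cmult_left:
  "mod_action l0 l1 \<epsilon> r (\<lambda>u t. c * f u t) \<xi> = (\<lambda>x k. c * mod_action l0 l1 \<epsilon> r f \<xi> x k)"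
  by (simp add: mod_action_def fourier_coeff_cmult mult.assoc infsum_cmult_right')

lemma mod_action_cmult_right:
  "mod_action l0 l1 \<epsilon> r f (\<lambda>x k. c * \<xi> x k) = (\<lambda>x k. c * mod_action l0 l1 \<epsilon> r f \<xi> x k)"
  by (simp add: mod_action_def mult.left_commute[of _ c] infsum_cmult_right')

section \<open>Associativity and the connection\<close>

lemma fourier_coeff_abs_summable:
  assumes "f \<in> schwartz_cyl"
  shows "(\<lambda>n. norm (fourier_coeff f n (u n))) summable_on UNIV"
proof -
  obtain C where C: "\<And>n u. norm (fourier_coeff f n u) \<le> C * (1 / (1 + \<bar>real_of_int n\<bar>) ^ 2)"
    using fourier_coeff_bound[OF assms, where b = 0, unfolded add_0] by metis
  show ?thesis
    by (rule Infinite_Sum.abs_summable_on_comparison_test'[OF summable_on_cmult_right[OF summable_on_int_inverse_square]])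
      (rule C)
qed

text \<open>The majorant is the product of two summable weights in \<open>k\<close> and
  \<open>m\<close>, transported by the bijection that sends \<open>(k, m)\<close> to
  \<open>(k + m, k)\<close>.\<close>

lemma convolution_abs_summable:
  fixes F :: "int \<Rightarrow> int \<Rightarrow> complex"
  assumes "\<And>n k. norm (F n k) \<le> C *
    (1 / (1 + \<bar>real_of_int k\<bar>) ^ 2 * (1 / (1 + \<bar>real_of_int (n - k)\<bar>) ^ 2))"
  shows "(\<lambda>p. norm ((\<lambda>(n, k). F n k) p)) summable_on UNIV \<times> UNIV"
proof -
  define w where "w n = 1 / (1 + \<bar>real_of_int n\<bar>) ^ 2" for n
  have w: "w summable_on UNIV" "w n \<ge> 0" for n
    using summable_on_int_inverse_square by (simp_all add: w_def[abs_def])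
  have "(\<lambda>p. norm ((\<lambda>(k, m). w k * w m) p)) summable_on UNIV \<times> UNIV"
    unfolding Infinite_Sum.abs_summable_on_Sigma_iff
    by (simp add: w abs_mult infsum_cmult_right' infsum_nonneg summable_on_cmult_right summable_on_cmult_left)
  then have "(\<lambda>(k, m). w k * w m) summable_on UNIV \<times> UNIV"
    by (rule abs_summable_summable)
  also have "?this \<longleftrightarrow> (\<lambda>(n, k). w k * w (n - k)) summable_on UNIV \<times> UNIV"
    by (rule summable_on_reindex_bij_witness[where i = "\<lambda>(n, k). (k, n - k)" and j = "\<lambda>(k, m). (k + m, k)"]) auto
  finally have "(\<lambda>p. C * (\<lambda>(n, k). w k * w (n - k)) p) summable_on UNIV \<times> UNIV"
    by (rule summable_on_cmult_right)
  then show ?thesis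
    by (rule Infinite_Sum.abs_summable_on_comparison_test') (use assms in \<open>auto simp: w_def\<close>)
qed

text \<open>The arguments \<open>u\<close> and \<open>v\<close> are independent, so the bound covers
  the twist \<open>v = u + of_int k * h\<close> for every \<open>k\<close>.\<close>

lemma twisted_convolution_bound:
  assumes "f \<in> schwartz_cyl" "g \<in> schwartz_cyl"
  obtains C where "0 \<le> C" "\<And>n k u v. norm (fourier_coeff f k u * fourier_coeff g (n - k) v)
    \<le> C * (1 / (1 + \<bar>real_of_int k\<bar>) ^ 2 * (1 / (1 + \<bar>real_of_int (n - k)\<bar>) ^ 2))"
proof -
  obtain C where C: "0 \<le> C" "\<And>n u. norm (fourier_coeff f n u) \<le> C * (1 / (1 + \<bar>real_of_int n\<bar>) ^ 2)"
    using fourier_coeff_bound[OF assms(1), where b = 0, unfolded add_0] by metis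
  obtain D where D: "0 \<le> D" "\<And>n u. norm (fourier_coeff g n u) \<le> D * (1 / (1 + \<bar>real_of_int n\<bar>) ^ 2)"
    using fourier_coeff_bound[OF assms(2), where b = 0, unfolded add_0] by metis
  have "norm (fourier_coeff f k u * fourier_coeff g (n - k) v)
    \<le> (C * D) * (1 / (1 + \<bar>real_of_int k\<bar>) ^ 2 * (1 / (1 + \<bar>real_of_int (n - k)\<bar>) ^ 2))" for n k u v
    using mult_mono[OF C(2)[of k u] D(2)[of "n - k" v]] C(1) by (simp add: norm_mult)
  then show ?thesis using C(1) D(1) by (intro that[of "C * D"]) simp_all
qed

text \<open>Absolute summability over all pairs makes the inner sums absolutely summable in
  \<open>n\<close>, so they can be read off the defining series by
  \<open>fourier_coeff_infsum\<close>.\<close>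

lemma fourier_coeff_cyl_mult:
  assumes "f \<in> schwartz_cyl" "g \<in> schwartz_cyl"
  shows "fourier_coeff (cyl_mult h f g) n u
    = (\<Sum>\<^sub>\<infinity>k. fourier_coeff f k u * fourier_coeff g (n - k) (u + of_int k * h))"
proof -
  let ?F = "\<lambda>n k. fourier_coeff f k u * fourier_coeff g (n - k) (u + of_int k * h)"
  obtain C where C: "\<And>n k u v. norm (fourier_coeff f k u * fourier_coeff g (n - k) v)
    \<le> C * (1 / (1 + \<bar>real_of_int k\<bar>) ^ 2 * (1 / (1 + \<bar>real_of_int (n - k)\<bar>) ^ 2))"
    using twisted_convolution_bound[OF assms] by metis
  have "(\<lambda>p. norm ((\<lambda>(n, k). ?F n k) p)) summable_on UNIV \<times> UNIV"
    by (rule convolution_abs_summable[OF C])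
  then have s: "(\<lambda>k. norm (?F n k)) summable_on UNIV"
    and "(\<lambda>n. norm (\<Sum>\<^sub>\<infinity>k. norm (?F n k))) summable_on UNIV" for n
    unfolding Infinite_Sum.abs_summable_on_Sigma_iff by auto
  then have "(\<lambda>n. \<Sum>\<^sub>\<infinity>k. norm (?F n k)) summable_on UNIV"
    by (intro abs_summable_summable[of "\<lambda>n. \<Sum>\<^sub>\<infinity>k. norm (?F n k)"])
  then have "(\<lambda>n. norm (\<Sum>\<^sub>\<infinity>k. ?F n k)) summable_on UNIV"
    by (rule Infinite_Sum.abs_summable_on_comparison_test') (rule norm_infsum_bound[OF s])
  then show ?thesis
    unfolding cyl_mult_def
    by (rule fourier_coeff_infsum[of
        "\<lambda>n u. \<Sum>\<^sub>\<infinity>k. fourier_coeff f k u * fourier_coeff g (n - k) (u + of_int k * h)"])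
qed

text \<open>Both sides are one absolutely convergent double sum: on the left the outer index is the
  total degree \<open>n\<close>, on the right it is the degree \<open>k\<close> taken from
  \<open>f\<close>.\<close>

lemma mod_action_cyl_mult:
  assumes f: "f \<in> schwartz_cyl" and g: "g \<in> schwartz_cyl" and \<xi>: "\<xi> \<in> schwartz_mod"
    and h: "l0 * \<epsilon> + l1 * real_of_int r = - h"
  shows "mod_action l0 l1 \<epsilon> r (cyl_mult h f g) \<xi>
    = mod_action l0 l1 \<epsilon> r f (mod_action l0 l1 \<epsilon> r g \<xi>)"
proof (intro ext)
  fix x j
  define u where "u = l0 * x + l1 * of_int j"
  define z where "z n = \<xi> (x - of_int n * \<epsilon>) (j - n * r)" for n
  let ?F = "\<lambda>n k. fourier_coeff f k u * fourier_coeff g (n - k) (u + of_int k * h)"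
  obtain C where C: "0 \<le> C" "\<And>n k u v. norm (fourier_coeff f k u * fourier_coeff g (n - k) v)
    \<le> C * (1 / (1 + \<bar>real_of_int k\<bar>) ^ 2 * (1 / (1 + \<bar>real_of_int (n - k)\<bar>) ^ 2))"
    using twisted_convolution_bound[OF f g] by metis
  obtain D where "0 \<le> D" "\<And>x k. (1 + \<bar>x\<bar>) ^ 0 * (1 + \<bar>real_of_int k\<bar>) ^ 0 * norm (\<xi> x k) \<le> D"
    using rapid_decayE[OF schwartz_mod_decay[OF \<xi>]] by metis
  then have D: "norm (z n) \<le> D" for n by (simp add: z_def)
  have "norm (?F n k * z n) \<le> (C * D) *
      (1 / (1 + \<bar>real_of_int k\<bar>) ^ 2 * (1 / (1 + \<bar>real_of_int (n - k)\<bar>) ^ 2))" for n k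
    using mult_mono[OF C(2)[of k u n "u + of_int k * h"] D[of n]] C(1)
    by (simp add: norm_mult mult_ac)
  then have "(\<lambda>p. norm ((\<lambda>(n, k). ?F n k * z n) p)) summable_on UNIV \<times> UNIV"
    by (rule convolution_abs_summable)
  then have s: "(\<lambda>(n, k). ?F n k * z n) summable_on UNIV \<times> UNIV"
    by (rule abs_summable_summable)
  have "mod_action l0 l1 \<epsilon> r (cyl_mult h f g) \<xi> x j = (\<Sum>\<^sub>\<infinity>n. (\<Sum>\<^sub>\<infinity>k. ?F n k) * z n)"
    unfolding mod_action_def fourier_coeff_cyl_mult[OF f g] by (simp add: u_def z_def)
  also have "\<dots> = (\<Sum>\<^sub>\<infinity>n. \<Sum>\<^sub>\<infinity>k. ?F n k * z n)"
    by (simp only: infsum_cmult_left')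
  also have "\<dots> = (\<Sum>\<^sub>\<infinity>k. \<Sum>\<^sub>\<infinity>n. ?F n k * z n)"
    by (rule infsum_swap_banach[OF s])
  also have "\<dots> = (\<Sum>\<^sub>\<infinity>k. fourier_coeff f k u * mod_action l0 l1 \<epsilon> r g \<xi> (x - of_int k * \<epsilon>) (j - k * r))"
  proof (intro infsum_cong)
    fix k
    \<comment> \<open>Moving \<open>(x, j)\<close> by \<open>k\<close> steps changes the argument by
      \<open>- k * (l0 * \<epsilon> + l1 * r)\<close>, which is exactly the twist
      \<open>k * h\<close> of the product.\<close>
    have u: "l0 * (x - of_int k * \<epsilon>) + l1 * of_int (j - k * r) = u + of_int k * h"
      using arg_cong[OF h, of "\<lambda>y. of_int k * y"] by (simp add: u_def algebra_simps)
    have z: "z (n + k) = \<xi> (x - of_int k * \<epsilon> - of_int n * \<epsilon>) (j - k * r - n * r)" for n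
      by (simp add: z_def algebra_simps)
    have "(\<Sum>\<^sub>\<infinity>n. ?F n k * z n)
        = (\<Sum>\<^sub>\<infinity>n. fourier_coeff f k u * (fourier_coeff g n (u + of_int k * h) * z (n + k)))"
      \<comment> \<open>Replacing \<open>n\<close> by \<open>n + k\<close> turns the index
        \<open>n - k\<close> of the coefficient of \<open>g\<close> into \<open>n\<close>.\<close>
      by (rule infsum_reindex_bij_witness[of _ "\<lambda>n. n + k" "\<lambda>n. n - k"]) (auto simp: mult_ac)
    also have "\<dots> = fourier_coeff f k u * (\<Sum>\<^sub>\<infinity>n. fourier_coeff g n (u + of_int k * h) * z (n + k))"
      by (rule infsum_cmult_right')
    finally show "(\<Sum>\<^sub>\<infinity>n. ?F n k * z n)
        = fourier_coeff f k u * mod_action l0 l1 \<epsilon> r g \<xi> (x - of_int k * \<epsilon>) (j - k * r)"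
      unfolding mod_action_def u by (simp add: z)
  qed
  also have "\<dots> = mod_action l0 l1 \<epsilon> r f (mod_action l0 l1 \<epsilon> r g \<xi>) x j"
    by (simp add: mod_action_def[of l0 l1 \<epsilon> r f] u_def)
  finally show "mod_action l0 l1 \<epsilon> r (cyl_mult h f g) \<xi> x j
    = mod_action l0 l1 \<epsilon> r f (mod_action l0 l1 \<epsilon> r g \<xi>) x j" .
qed

lemma left_module_mod_action:
  assumes "l0 * \<epsilon> + l1 * real_of_int r = - h"
  shows "left_module h (mod_action l0 l1 \<epsilon> r)"
  unfolding left_module_def
  using mod_action_schwartz_mod mod_action_add_left mod_action_add_right
    mod_action_cmult_left mod_action_cmult_right mod_action_cyl_mult[OF _ _ _ assms]
  by (intro conjI ballI allI) simp_all

section \<open>The derivations and the Leibniz rules\<close>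

text \<open>\<open>mod_action\<close> sees its algebra argument only through Fourier coefficients,
  so this equality lets \<open>partial_u f\<close> stand in for the series
  \<open>cyl_deriv1 f\<close>.\<close>

lemma fourier_coeff_cyl_deriv1:
  assumes "f \<in> schwartz_cyl"
  shows "fourier_coeff (cyl_deriv1 f) n u = fourier_coeff (partial_u f) n u"
proof -
  have "vector_derivative (fourier_coeff f n) (at u) = fourier_coeff (partial_u f) n u" for n u
    by (rule vector_derivative_at[OF fourier_coeff_has_vector_derivative[OF assms]])
  then show ?thesis
    using fourier_coeff_infsum[OF fourier_coeff_abs_summable[OF partial_u_schwartz_cyl[OF assms]]]
    by (simp add: cyl_deriv1_def)
qed

text \<open>The factor \<open>2 * pi * \<i> * n\<close> turns the defining series into the Fourier
  series of \<open>partial_t f\<close>, whose coefficients are absolutely summable.\<close>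

lemma fourier_coeff_cyl_deriv2:
  assumes "f \<in> schwartz_cyl"
  shows "fourier_coeff (cyl_deriv2 f) n u = fourier_coeff (partial_t f) n u"
proof -
  have "cyl_deriv2 f = (\<lambda>u t. \<Sum>\<^sub>\<infinity>n. fourier_coeff (partial_t f) n u * W_power n t)"
    by (simp add: cyl_deriv2_def fourier_coeff_partial_t[OF assms] mult.assoc infsum_cmult_right')
  then show ?thesis
    using fourier_coeff_infsum[OF fourier_coeff_abs_summable[OF partial_t_schwartz_cyl[OF assms]]]
    by simp
qed

lemma covariant_derivative_nabla1:
  assumes "l0 \<noteq> 0" "\<alpha> = 1 / complex_of_real l0"
  shows "covariant_derivative (mod_action l0 l1 \<epsilon> r) cyl_deriv1 (nabla1 \<alpha>)"
  unfolding covariant_derivative_def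
proof (intro conjI ballI allI)
  fix f \<xi> assume f: "f \<in> schwartz_cyl" and \<xi>: "\<xi> \<in> schwartz_mod"
  have "mod_action l0 l1 \<epsilon> r (cyl_deriv1 f) \<xi> = mod_action l0 l1 \<epsilon> r (partial_u f) \<xi>"
    by (simp add: mod_action_def fourier_coeff_cyl_deriv1[OF f])
  \<comment> \<open>Cancels the inner derivative \<open>l0\<close> in front of the
    \<open>partial_u f\<close> term.\<close>
  moreover have "\<alpha> * of_real l0 = 1" using assms by simp
  ultimately show "nabla1 \<alpha> (mod_action l0 l1 \<epsilon> r f \<xi>)
      = (\<lambda>x k. mod_action l0 l1 \<epsilon> r f (nabla1 \<alpha> \<xi>) x k + mod_action l0 l1 \<epsilon> r (cyl_deriv1 f) \<xi> x k)"
    by (simp add: nabla1_def partial_x_mod_action[OF f \<xi>] mod_action_cmult_right distrib_left add.commute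
        flip: mult.assoc)
next
  fix \<xi> \<eta> assume \<xi>: "\<xi> \<in> schwartz_mod" and \<eta>: "\<eta> \<in> schwartz_mod"
  have "partial_x (\<lambda>x k. \<xi> x k + \<eta> x k) = (\<lambda>x k. partial_x \<xi> x k + partial_x \<eta> x k)"
    by (intro partial_x_eqI has_vector_derivative_add has_vector_derivative_partial_x \<xi> \<eta>)
  then show "nabla1 \<alpha> (\<lambda>x k. \<xi> x k + \<eta> x k) = (\<lambda>x k. nabla1 \<alpha> \<xi> x k + nabla1 \<alpha> \<eta> x k)"
    by (simp add: nabla1_def distrib_left)
next
  fix c \<xi> assume \<xi>: "\<xi> \<in> schwartz_mod"
  have "partial_x (\<lambda>x k. c * \<xi> x k) = (\<lambda>x k. c * partial_x \<xi> x k)"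
    by (intro partial_x_eqI has_vector_derivative_mult_right has_vector_derivative_partial_x \<xi>)
  then show "nabla1 \<alpha> (\<lambda>x k. c * \<xi> x k) = (\<lambda>x k. c * nabla1 \<alpha> \<xi> x k)"
    by (simp add: nabla1_def mult.left_commute)
next
  fix \<xi> assume "\<xi> \<in> schwartz_mod"
  then show "nabla1 \<alpha> \<xi> \<in> schwartz_mod"
    unfolding nabla1_def by (intro schwartz_mod_cmult schwartz_mod_partial_x)
qed

lemma nabla2_schwartz_mod:
  assumes "\<xi> \<in> schwartz_mod"
  shows "nabla2 \<beta> \<gamma> \<xi> \<in> schwartz_mod"
  unfolding nabla2_def mult.assoc
  by (intro schwartz_mod_add schwartz_mod_cmult schwartz_mod_mult_x schwartz_mod_mult_k assms)

lemma covariant_derivative_nabla2: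
  assumes "\<beta> * complex_of_real \<epsilon> + \<gamma> * of_int r = 2 * complex_of_real pi * \<i>"
  shows "covariant_derivative (mod_action l0 l1 \<epsilon> r) cyl_deriv2 (nabla2 \<beta> \<gamma>)"
  unfolding covariant_derivative_def
proof (intro conjI ballI allI)
  fix f \<xi> assume f: "f \<in> schwartz_cyl" and \<xi>: "\<xi> \<in> schwartz_mod"
  show "nabla2 \<beta> \<gamma> (mod_action l0 l1 \<epsilon> r f \<xi>)
      = (\<lambda>x k. mod_action l0 l1 \<epsilon> r f (nabla2 \<beta> \<gamma> \<xi>) x k + mod_action l0 l1 \<epsilon> r (cyl_deriv2 f) \<xi> x k)"
  proof (intro ext)
    fix x k
    let ?u = "l0 * x + l1 * of_int k" and ?x = "\<lambda>n. x - of_int n * \<epsilon>" and ?k = "\<lambda>n. k - n * r"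
    \<comment> \<open>The multiplier at \<open>(x, k)\<close> is its value at the shifted point plus
      \<open>2 * pi * \<i> * n\<close>; the excess turns the coefficient of \<open>f\<close> into
      that of \<open>partial_t f\<close>.\<close>
    have split: "(\<beta> * of_real x + \<gamma> * of_int k) * (fourier_coeff f n ?u * \<xi> (?x n) (?k n))
        = fourier_coeff f n ?u * nabla2 \<beta> \<gamma> \<xi> (?x n) (?k n)
          + fourier_coeff (partial_t f) n ?u * \<xi> (?x n) (?k n)" for n
      unfolding nabla2_def fourier_coeff_partial_t[OF f] assms[symmetric] by (simp add: algebra_simps)
    have "nabla2 \<beta> \<gamma> (mod_action l0 l1 \<epsilon> r f \<xi>) x k
        = (\<beta> * of_real x + \<gamma> * of_int k) * (\<Sum>\<^sub>\<infinity>n. fourier_coeff f n ?u * \<xi> (?x n) (?k n))"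
      by (simp add: nabla2_def mod_action_def distrib_right)
    also have "\<dots> = (\<Sum>\<^sub>\<infinity>n. fourier_coeff f n ?u * nabla2 \<beta> \<gamma> \<xi> (?x n) (?k n)
        + fourier_coeff (partial_t f) n ?u * \<xi> (?x n) (?k n))"
      by (simp only: split flip: infsum_cmult_right')
    also have "\<dots> = (\<Sum>\<^sub>\<infinity>n. fourier_coeff f n ?u * nabla2 \<beta> \<gamma> \<xi> (?x n) (?k n))
        + (\<Sum>\<^sub>\<infinity>n. fourier_coeff (partial_t f) n ?u * \<xi> (?x n) (?k n))"
      by (intro infsum_add mod_action_summable f partial_t_schwartz_cyl schwartz_mod_decay
          nabla2_schwartz_mod \<xi>)
    finally show "nabla2 \<beta> \<gamma> (mod_action l0 l1 \<epsilon> r f \<xi>) x k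
        = mod_action l0 l1 \<epsilon> r f (nabla2 \<beta> \<gamma> \<xi>) x k + mod_action l0 l1 \<epsilon> r (cyl_deriv2 f) \<xi> x k"
      by (simp add: mod_action_def fourier_coeff_cyl_deriv2[OF f])
  qed
qed (simp_all add: nabla2_schwartz_mod, simp_all add: nabla2_def algebra_simps)

theorem proposition4p10:
  fixes l0 l1 \<epsilon> h :: real and r :: int and \<alpha> \<beta> \<gamma> :: complex
  assumes "l0 * \<epsilon> + l1 * real_of_int r = - h"
    and "l0 \<noteq> 0"
    and "\<alpha> = 1 / complex_of_real l0"
    and "\<beta> * complex_of_real \<epsilon> + \<gamma> * of_int r = 2 * complex_of_real pi * \<i>"
  shows "left_module_connection h (mod_action l0 l1 \<epsilon> r) (nabla1 \<alpha>) (nabla2 \<beta> \<gamma>)"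
  unfolding left_module_connection_def
  using assms left_module_mod_action covariant_derivative_nabla1 covariant_derivative_nabla2 by blast

end
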